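(* Let $f:H\to\mathbb{R}$ be twice differentiable, attain its minimum value $f^*$, and satisfy the Polyak-Łojasiewicz inequality $\|\nabla f(z)\|^2\ge 2\mu\left(f(z)-f^*\right)$ for all $z\in H$, with constant $\mu>0$. Pick $\theta>0$ and let $\alpha>0$, $\beta>0$ and $\gamma=\theta+\alpha\beta$. Let $x:[0,\infty)\to H$ satisfy $$\ddot{x}(t)+\alpha\dot{x}(t)+\beta\nabla^2 f(x(t))\dot{x}(t)+\gamma\nabla f(x(t))=0$$ with $x(0)=x_0$ and $\dot{x}(0)=v_0$. If $v_0=-\beta\nabla f(x_0)$, then for every $t\ge 0$, $$f(x(t))-f^*\le\left(f(x_0)-f^*\right)e^{-2\delta t},$$ where $\delta:=\min\{\alpha,\mu\beta\}$.
   Context: $H$ is a real Hilbert space with norm $\|\cdot\|$. Convexity of $f$ is not assumed. *)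

theory Defs
  imports "HOL-Analysis.Analysis"
begin

end

theory Submission
  imports Defs
begin

text \<open>
  With $w = \dot x + \beta \nabla f(x)$ the second-order equation becomes
  $\dot w = - \alpha w - \theta \nabla f(x)$, and $w(0) = 0$ by the choice of $v_0$. Along
  $\dot x = w - \beta \nabla f(x)$ the cross terms in the derivative of
  $E = \theta (f(x) - f^*) + \|w\|^2 / 2$ cancel, which leaves
  $\dot E = - \theta \beta \|\nabla f(x)\|^2 - \alpha \|w\|^2 \le - 2 \delta E$.
\<close>

text \<open>Gronwall-type estimate by the integrating factor \<open>exp (c * s)\<close>: the
  differential inequality makes \<open>E s * exp (c * s)\<close> nonincreasing. Neither a sign of
  \<open>E\<close> nor a sign of \<open>c\<close> enters.\<close>

lemma exponential_decay:
  fixes E E' :: "real \<Rightarrow> real"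
  assumes deriv: "\<And>t. t \<ge> 0 \<Longrightarrow> (E has_real_derivative E' t) (at t within {0..})"
    and le: "\<And>t. t \<ge> 0 \<Longrightarrow> E' t \<le> - c * E t"
    and "t \<ge> 0"
  shows "E t \<le> E 0 * exp (- c * t)"
proof -
  define G where "G = (\<lambda>s. E s * exp (c * s))"
  have G: "(G has_real_derivative (E' s + c * E s) * exp (c * s)) (at s within {0..})"
    if "s \<ge> 0" for s
    unfolding G_def
    by (rule derivative_eq_intros deriv that refl)+ (simp add: algebra_simps)
  \<comment> \<open>At 0 only a one-sided derivative is given. The monotonicity criterion asks for
    two-sided derivatives on the open interval only, and for continuity up to the endpoints.\<close>
  have "G t \<le> G 0"
  proof (rule DERIV_nonpos_imp_decreasing_open[OF \<open>t \<ge> 0\<close>])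
    fix s assume s: "0 < s" "s < t"
    then have "at s within {0..} = at s"
      by (intro at_within_interior) simp
    with G[of s] s have "(G has_real_derivative (E' s + c * E s) * exp (c * s)) (at s)"
      by simp
    moreover have "(E' s + c * E s) * exp (c * s) \<le> 0"
      using le[of s] s by (intro mult_nonpos_nonneg) auto
    ultimately show "\<exists>y. (G has_real_derivative y) (at s) \<and> y \<le> 0"
      by blast
  next
    have "continuous_on {0..} G"
      using G by (auto intro!: DERIV_continuous_on)
    then show "continuous_on {0..t} G"
      by (rule continuous_on_subset) auto
  qed
  then show ?thesis
    by (simp add: G_def exp_minus field_simps)
qed

theorem theorem6:
  fixes f :: "'a::{real_inner, banach} \<Rightarrow> real"
    and grad :: "'a \<Rightarrow> 'a" and hess :: "'a \<Rightarrow> 'a \<Rightarrow> 'a"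
    and fstar \<mu> \<theta> \<alpha> \<beta> \<gamma> \<delta> :: real
    and x x' x'' :: "real \<Rightarrow> 'a" and x0 v0 :: 'a
  assumes "\<And>z. GDERIV f z :> grad z"
    and "\<And>z. (grad has_derivative hess z) (at z)"
    and "fstar \<in> range f" and "\<And>z. fstar \<le> f z"
    and "\<mu> > 0" and "\<And>z. (norm (grad z))\<^sup>2 \<ge> 2 * \<mu> * (f z - fstar)"
    and "\<theta> > 0" and "\<alpha> > 0" and "\<beta> > 0" and "\<gamma> = \<theta> + \<alpha> * \<beta>"
    and "\<And>t. t \<ge> 0 \<Longrightarrow> (x has_vector_derivative x' t) (at t within {0..})"
    and "\<And>t. t \<ge> 0 \<Longrightarrow> (x' has_vector_derivative x'' t) (at t within {0..})"
    and "\<And>t. t \<ge> 0 \<Longrightarrow>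
      x'' t + \<alpha> *\<^sub>R x' t + \<beta> *\<^sub>R hess (x t) (x' t) + \<gamma> *\<^sub>R grad (x t) = 0"
    and "x 0 = x0" and "x' 0 = v0"
    and "v0 = - (\<beta> *\<^sub>R grad x0)"
    and "\<delta> = min \<alpha> (\<mu> * \<beta>)"
  shows "\<forall>t\<ge>0. f (x t) - fstar \<le> (f x0 - fstar) * exp (- 2 * \<delta> * t)"
proof -
  note gderiv = assms(1) and hess = assms(2) and fstar = assms(4) and PL = assms(6)
    and x = assms(11) and x' = assms(12) and ode = assms(13)
  define g where "g = (\<lambda>t. grad (x t))"
  define w where "w = (\<lambda>t. x' t + \<beta> *\<^sub>R g t)"
  \<comment> \<open>The weight \<open>\<theta>\<close> equals the coefficient of \<open>g\<close> in
    the derivative of \<open>w\<close>, so that the terms in \<open>w t \<bullet> g t\<close> cancel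
    in \<open>E'\<close>.\<close>
  define E where "E = (\<lambda>t. \<theta> * (f (x t) - fstar) + (w t \<bullet> w t) / 2)"
  define E' where "E' t = - \<theta> * \<beta> * (g t \<bullet> g t) - \<alpha> * (w t \<bullet> w t)" for t
  have w: "(w has_vector_derivative - \<alpha> *\<^sub>R w t - \<theta> *\<^sub>R g t) (at t within {0..})"
    if "t \<ge> 0" for t
  proof -
    have "(g has_vector_derivative hess (x t) (x' t)) (at t within {0..})"
      using vector_derivative_diff_chain_within[OF x[OF that] has_derivative_at_withinI[OF hess]]
      by (simp add: g_def comp_def)
    then have "(w has_vector_derivative x'' t + \<beta> *\<^sub>R hess (x t) (x' t)) (at t within {0..})"
      unfolding w_def
      by (intro has_vector_derivative_add x'[OF that]
          bounded_linear.has_vector_derivative[OF bounded_linear_scaleR_right])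
    \<comment> \<open>The Hessian term of the equation is exactly the derivative of
      \<open>\<beta> *\<^sub>R g\<close>. Splitting \<open>\<gamma>\<close> as
      \<open>\<theta> + \<alpha> * \<beta>\<close> then turns the right-hand side into
      \<open>- \<alpha> *\<^sub>R w t - \<theta> *\<^sub>R g t\<close>.\<close>
    moreover have "x'' t + \<beta> *\<^sub>R hess (x t) (x' t) = - \<alpha> *\<^sub>R x' t - \<gamma> *\<^sub>R g t"
      using ode[OF that] by (simp add: g_def add_eq_0_iff2 algebra_simps)
    ultimately show ?thesis
      by (simp add: w_def assms(10) algebra_simps)
  qed
  have fx: "((\<lambda>s. f (x s)) has_real_derivative x' t \<bullet> g t) (at t within {0..})"
    if "t \<ge> 0" for t
    using vector_derivative_diff_chain_within[OF x[OF that]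
        has_derivative_at_withinI[OF gderiv[unfolded gderiv_def]]]
    by (simp add: g_def comp_def has_real_derivative_iff_has_vector_derivative)
  have E: "(E has_real_derivative E' t) (at t within {0..})" if "t \<ge> 0" for t
  proof -
    have ww: "((\<lambda>s. w s \<bullet> w s) has_real_derivative 2 * (w t \<bullet> (- \<alpha> *\<^sub>R w t - \<theta> *\<^sub>R g t)))
        (at t within {0..})"
      using bounded_bilinear.has_vector_derivative[OF bounded_bilinear_inner w[OF that] w[OF that]]
      by (simp add: has_real_derivative_iff_has_vector_derivative inner_commute)
    have x'_eq: "x' t = w t - \<beta> *\<^sub>R g t"
      by (simp add: w_def)
    show ?thesis
      unfolding E_def
      by (auto intro!: derivative_eq_intros fx[OF that] ww
          simp: E'_def x'_eq inner_diff inner_commute field_simps)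
  qed
  have decay: "E' t \<le> - (2 * \<delta>) * E t" if "t \<ge> 0" for t
  proof -
    \<comment> \<open>The bound \<open>\<delta> \<le> \<mu> * \<beta>\<close> serves the potential
      part of \<open>E\<close>, where minimality of \<open>fstar\<close> makes the factor
      nonnegative; \<open>\<delta> \<le> \<alpha>\<close> later serves the part with
      \<open>w\<close>.\<close>
    have "\<delta> * (f (x t) - fstar) \<le> \<mu> * \<beta> * (f (x t) - fstar)"
      using fstar[of "x t"] assms(17) by (intro mult_right_mono) auto
    \<comment> \<open>PL scaled by \<open>\<beta>\<close>. The chain substitutes the previous bound
      under multiplication by 2; the resulting monotonicity condition is discharged by the closing
      \<open>simp\<close>.\<close>
    also have "2 * \<dots> \<le> \<beta> * (g t \<bullet> g t)"
      using mult_left_mono[OF PL[of "x t"], of \<beta>] \<open>\<beta> > 0\<close>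
      by (simp add: g_def power2_norm_eq_inner mult_ac)
    finally have "2 * (\<delta> * (f (x t) - fstar)) \<le> \<beta> * (g t \<bullet> g t)"
      by simp
    from mult_left_mono[OF this, of \<theta>]
    have "2 * \<delta> * (\<theta> * (f (x t) - fstar)) \<le> \<theta> * \<beta> * (g t \<bullet> g t)"
      using \<open>\<theta> > 0\<close> by (simp add: mult_ac)
    moreover have "\<delta> * (w t \<bullet> w t) \<le> \<alpha> * (w t \<bullet> w t)"
      using assms(17) by (intro mult_right_mono) auto
    ultimately show ?thesis
      by (simp add: E_def E'_def algebra_simps)
  qed
  \<comment> \<open>Since \<open>w 0 = 0\<close>, no kinetic term remains, and the final bound has
    constant exactly \<open>f x0 - fstar\<close> once \<open>\<theta>\<close> is cancelled.\<close>
  have E0: "E 0 = \<theta> * (f x0 - fstar)"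
    using assms(14-16) by (simp add: E_def w_def g_def)
  show ?thesis
  proof (intro allI impI)
    fix t :: real assume "t \<ge> 0"
    \<comment> \<open>Drops the nonnegative term \<open>(w t \<bullet> w t) / 2\<close>.\<close>
    have "\<theta> * (f (x t) - fstar) \<le> E t"
      by (simp add: E_def)
    also have "\<dots> \<le> E 0 * exp (- (2 * \<delta>) * t)"
      using E decay \<open>t \<ge> 0\<close> by (rule exponential_decay)
    finally have "\<theta> * (f (x t) - fstar) \<le> \<theta> * ((f x0 - fstar) * exp (- 2 * \<delta> * t))"
      by (simp add: E0 mult.assoc)
    with \<open>\<theta> > 0\<close> show "f (x t) - fstar \<le> (f x0 - fstar) * exp (- 2 * \<delta> * t)"
      by simp
  qed
qed

end
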